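(* Let $K$ be a field and let $\widetilde{K}$ denote the set of arithmetically fixed elements of $K$. Then $$\widetilde{K}=\{x \in K : \{x\} \text{ is existentially first-order definable in } K \text{ in the language of rings without parameters}\}.$$
   Context: Let $K$ be a field and $A\subseteq K$. A map $f:A\to K$ is called arithmetic if: (1) if $1\in A$ then $f(1)=1$; (2) if $a,b\in A$ and $a+b\in A$ then $f(a+b)=f(a)+f(b)$; (3) if $a,b\in A$ and $a\cdot b\in A$ then $f(a\cdot b)=f(a)\cdot f(b)$. An element $r\in K$ is called arithmetically fixed if there is a finite set $A(r)\subseteq K$ with $r\in A(r)$ (an arithmetic neighbourhood of $r$) such that every arithmetic map $f:A(r)\to K$ satisfies $f(r)=r$. The set of arithmetically fixed elements of $K$ is denoted $\widetilde{K}$. The set $\{r\}$ is existentially first-order definable in $K$ without parameters if there is a quantifier-free formula $\Gamma(x,x_1,\dots,x_n)$ of the language of rings such that $\{r\}=\{x\in K : K\models \exists x_1\dots\exists x_n\,\Gamma(x,x_1,\dots,x_n)\}$. *)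

theory Defs
  imports Main
begin

definition arithmetic_on :: "'a::field set \<Rightarrow> ('a \<Rightarrow> 'a) \<Rightarrow> bool" where
  "arithmetic_on A f \<longleftrightarrow>
     (1 \<in> A \<longrightarrow> f 1 = 1) \<and>
     (\<forall>a\<in>A. \<forall>b\<in>A. a + b \<in> A \<longrightarrow> f (a + b) = f a + f b) \<and>
     (\<forall>a\<in>A. \<forall>b\<in>A. a * b \<in> A \<longrightarrow> f (a * b) = f a * f b)"

text \<open>A map from \<open>A\<close> to the field is represented by a total function; its values outside
  \<open>A\<close> are irrelevant in both of these definitions.\<close>

definition arithmetically_fixed :: "'a::field \<Rightarrow> bool" where
  "arithmetically_fixed r \<longleftrightarrow>
     (\<exists>A. finite A \<and> r \<in> A \<and> (\<forall>f. arithmetic_on A f \<longrightarrow> f r = r))"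

text \<open>The language of rings has the symbols \<open>0, 1, +, -, \<cdot>\<close>, where \<open>-\<close> is unary.\<close>

datatype ring_term =
    Var nat
  | Zero
  | One
  | Add ring_term ring_term
  | Neg ring_term
  | Mult ring_term ring_term

datatype qf_formula =
    Eq ring_term ring_term
  | Not qf_formula
  | And qf_formula qf_formula
  | Or qf_formula qf_formula

primrec term_vars :: "ring_term \<Rightarrow> nat set" where
  "term_vars (Var i) = {i}"
| "term_vars Zero = {}"
| "term_vars One = {}"
| "term_vars (Add s t) = term_vars s \<union> term_vars t"
| "term_vars (Neg t) = term_vars t"
| "term_vars (Mult s t) = term_vars s \<union> term_vars t"

primrec formula_vars :: "qf_formula \<Rightarrow> nat set" where
  "formula_vars (Eq s t) = term_vars s \<union> term_vars t"
| "formula_vars (Not \<phi>) = formula_vars \<phi>"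
| "formula_vars (And \<phi> \<psi>) = formula_vars \<phi> \<union> formula_vars \<psi>"
| "formula_vars (Or \<phi> \<psi>) = formula_vars \<phi> \<union> formula_vars \<psi>"

primrec term_val :: "(nat \<Rightarrow> 'a::field) \<Rightarrow> ring_term \<Rightarrow> 'a" where
  "term_val v (Var i) = v i"
| "term_val v Zero = 0"
| "term_val v One = 1"
| "term_val v (Add s t) = term_val v s + term_val v t"
| "term_val v (Neg t) = - term_val v t"
| "term_val v (Mult s t) = term_val v s * term_val v t"

primrec holds :: "(nat \<Rightarrow> 'a::field) \<Rightarrow> qf_formula \<Rightarrow> bool" where
  "holds v (Eq s t) \<longleftrightarrow> term_val v s = term_val v t"
| "holds v (Not \<phi>) \<longleftrightarrow> \<not> holds v \<phi>"
| "holds v (And \<phi> \<psi>) \<longleftrightarrow> holds v \<phi> \<and> holds v \<psi>"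
| "holds v (Or \<phi> \<psi>) \<longleftrightarrow> holds v \<phi> \<or> holds v \<psi>"

text \<open>In \<open>\<Gamma>(x, x\<^sub>1, \<dots>, x\<^sub>n)\<close> the variable \<open>Var 0\<close> stands for \<open>x\<close> and \<open>Var i\<close> for \<open>x\<^sub>i\<close>,
  so the list \<open>xs\<close> below carries the values of \<open>x\<^sub>1, \<dots>, x\<^sub>n\<close>.\<close>

definition existentially_definable :: "'a::field set \<Rightarrow> bool" where
  "existentially_definable S \<longleftrightarrow>
     (\<exists>n \<Gamma>. formula_vars \<Gamma> \<subseteq> {0..n} \<and>
        S = {x. \<exists>xs. length xs = n \<and> holds (\<lambda>i. (x # xs) ! i) \<Gamma>})"

end

(* An arithmetic neighbourhood of r is the same thing as a finite system of equations
   1 = x, x + y = z, x y = z with a solution in K, every solution of which takes the value r at a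
   distinguished unknown; this is an existential formula. Conversely, given Gamma and a witness in
   K, close the witness under the subterms of Gamma and add an inverse of s - t for every pair of
   distinct sides of an atomic formula s = t. An arithmetic map on the resulting finite set
   preserves both equations and inequations, so it maps the witness to another witness. *)
theory Submission
  imports Defs
begin

lemma term_val_cong:
  "(\<And>i. i \<in> term_vars t \<Longrightarrow> v i = w i) \<Longrightarrow> term_val v t = term_val w t"
  by (induction t) auto

lemma holds_cong:
  assumes "\<And>i. i \<in> formula_vars \<phi> \<Longrightarrow> v i = w i"
  shows "holds v \<phi> \<longleftrightarrow> holds w \<phi>"
  using assms
proof (induction \<phi>)
  case (Eq s t)
  then have "term_val v s = term_val w s" "term_val v t = term_val w t"
    by (auto intro!: term_val_cong)
  then show ?case by simp
qed auto

text \<open>The formula language has no symbol for truth; \<open>Eq Zero Zero\<close> serves as the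
  empty conjunction and contributes no variables.\<close>

definition conj_list :: "qf_formula list \<Rightarrow> qf_formula" where
  "conj_list \<phi>s = foldr And \<phi>s (Eq Zero Zero)"

lemma holds_conj_list [simp]: "holds v (conj_list \<phi>s) \<longleftrightarrow> (\<forall>\<phi>\<in>set \<phi>s. holds v \<phi>)"
  by (induction \<phi>s) (auto simp: conj_list_def)

lemma formula_vars_conj_list [simp]:
  "formula_vars (conj_list \<phi>s) = (\<Union>\<phi>\<in>set \<phi>s. formula_vars \<phi>)"
  by (induction \<phi>s) (auto simp: conj_list_def)

text \<open>The positive diagram of the entries of \<open>L\<close>, with \<open>Var i\<close>
  naming \<open>L ! i\<close>. Only equations are recorded, because arithmetic maps are constrained
  by equations alone.\<close>

definition diagram :: "'a::field list \<Rightarrow> qf_formula" where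
  "diagram L = (let I = [0..<length L] in conj_list (
     [Eq (Var i) One. i \<leftarrow> I, L ! i = 1] @
     [Eq (Add (Var i) (Var j)) (Var k). i \<leftarrow> I, j \<leftarrow> I, k \<leftarrow> I, L ! i + L ! j = L ! k] @
     [Eq (Mult (Var i) (Var j)) (Var k). i \<leftarrow> I, j \<leftarrow> I, k \<leftarrow> I, L ! i * L ! j = L ! k]))"

lemma formula_vars_diagram: "formula_vars (diagram L) \<subseteq> {..<length L}"
  by (auto simp: diagram_def Let_def split: if_splits)

lemma holds_diagram:
  "holds v (diagram L) \<longleftrightarrow>
     (\<forall>i<length L. L ! i = 1 \<longrightarrow> v i = 1) \<and>
     (\<forall>i<length L. \<forall>j<length L. \<forall>k<length L. L ! i + L ! j = L ! k \<longrightarrow> v i + v j = v k) \<and>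
     (\<forall>i<length L. \<forall>j<length L. \<forall>k<length L. L ! i * L ! j = L ! k \<longrightarrow> v i * v j = v k)"
  by (simp add: diagram_def Let_def ball_Un ball_UN atLeast0LessThan)
    (intro arg_cong2[where f = conj]; blast)

lemma arithmetic_on_iff_holds_diagram:
  "arithmetic_on (set L) f \<longleftrightarrow> holds (\<lambda>i. f (L ! i)) (diagram L)"
proof -
  \<comment> \<open>Naming the sum or product by a third element \<open>c\<close> of
    \<open>A\<close> replaces the membership premises, so that the conditions range over triples
    just as in the diagram.\<close>
  have "arithmetic_on A f \<longleftrightarrow>
      (\<forall>a\<in>A. a = 1 \<longrightarrow> f a = 1) \<and>
      (\<forall>a\<in>A. \<forall>b\<in>A. \<forall>c\<in>A. a + b = c \<longrightarrow> f a + f b = f c) \<and>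
      (\<forall>a\<in>A. \<forall>b\<in>A. \<forall>c\<in>A. a * b = c \<longrightarrow> f a * f b = f c)" for A
    unfolding arithmetic_on_def by (intro arg_cong2[where f = conj]) auto
  from this[of "set L"] show ?thesis
    unfolding holds_diagram all_set_conv_all_nth .
qed

lemma existentially_definable_if_arithmetically_fixed:
  fixes r :: "'a::field"
  assumes "arithmetically_fixed r"
  shows "existentially_definable {r}"
proof -
  obtain A where "finite A" "r \<in> A" and fixed: "\<And>f. arithmetic_on A f \<Longrightarrow> f r = r"
    using assms unfolding arithmetically_fixed_def by blast
  \<comment> \<open>With \<open>r\<close> at the head of the list, \<open>Var 0\<close> names
    \<open>r\<close>. Distinctness is what later allows a tuple to be read as a map on
    \<open>A\<close>.\<close>
  obtain as where as: "set as = A - {r}" "distinct as"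
    using \<open>finite A\<close> finite_distinct_list by blast
  define L where "L = r # as"
  have L: "set L = A" "distinct L" "L ! 0 = r"
    using as \<open>r \<in> A\<close> by (auto simp: L_def)
  \<comment> \<open>The identity map is arithmetic, so the neighbourhood itself solves its
    diagram.\<close>
  have "holds (\<lambda>i. (r # as) ! i) (diagram L)"
    using arithmetic_on_iff_holds_diagram[of L "\<lambda>x. x"]
    by (auto simp: arithmetic_on_def L_def)
  moreover have "x = r"
    if "length xs = length as" and holds: "holds (\<lambda>i. (x # xs) ! i) (diagram L)" for x xs
  proof -
    \<comment> \<open>A solution of the diagram becomes the map sending \<open>L ! i\<close> to its
      \<open>i\<close>-th entry; the values of \<open>f\<close> outside \<open>A\<close> do not
      matter.\<close>
    define f where "f a = the (map_of (zip L (x # xs)) a)" for a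
    have f: "f (L ! i) = (x # xs) ! i" if "i < length L" for i
      using that L(2) \<open>length xs = length as\<close> map_of_zip_nth[of L "x # xs" i]
      by (simp add: f_def L_def del: zip_Cons_Cons)
    have "holds (\<lambda>i. f (L ! i)) (diagram L)"
      using holds f formula_vars_diagram[of L]
      by (subst holds_cong[where w = "\<lambda>i. (x # xs) ! i"]) auto
    then have "f r = r"
      using fixed L(1) arithmetic_on_iff_holds_diagram[of L f] by blast
    then show ?thesis
      using f[of 0] by (simp add: L_def)
  qed
  ultimately have "{r} = {x. \<exists>xs. length xs = length as \<and> holds (\<lambda>i. (x # xs) ! i) (diagram L)}"
    by blast
  moreover have "formula_vars (diagram L) \<subseteq> {0..length as}"
    using formula_vars_diagram[of L] by (auto simp: L_def)
  ultimately show ?thesis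
    unfolding existentially_definable_def by blast
qed

lemma arithmetic_on_one: "arithmetic_on A f \<Longrightarrow> 1 \<in> A \<Longrightarrow> f 1 = 1"
  and arithmetic_on_add:
    "arithmetic_on A f \<Longrightarrow> a \<in> A \<Longrightarrow> b \<in> A \<Longrightarrow> a + b \<in> A \<Longrightarrow> f (a + b) = f a + f b"
  and arithmetic_on_mult:
    "arithmetic_on A f \<Longrightarrow> a \<in> A \<Longrightarrow> b \<in> A \<Longrightarrow> a * b \<in> A \<Longrightarrow> f (a * b) = f a * f b"
  by (auto simp: arithmetic_on_def)

lemma arithmetic_on_zero: "arithmetic_on A f \<Longrightarrow> 0 \<in> A \<Longrightarrow> f 0 = 0"
  using arithmetic_on_add[of A f 0 0] by (metis add_0_right add_left_imp_eq)

lemma arithmetic_on_uminus: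
  assumes "arithmetic_on A f" "a \<in> A" "- a \<in> A" "0 \<in> A"
  shows "f (- a) = - f a"
  using arithmetic_on_add[of A f a "- a"] arithmetic_on_zero[of A f] assms
  by (simp add: eq_neg_iff_add_eq_0 add.commute)

text \<open>If \<open>f a = f b\<close>, additivity at \<open>b + (a - b) = a\<close> forces
  \<open>f (a - b) = 0\<close>. But \<open>a - b\<close> times its inverse is 1, so applying
  \<open>f\<close> would give \<open>0 = 1\<close>.\<close>

lemma arithmetic_on_neq:
  assumes "arithmetic_on A f" "{1, a, b, a - b, inverse (a - b)} \<subseteq> A" "a \<noteq> b"
  shows "f a \<noteq> f b"
proof
  assume "f a = f b"
  then have "f (a - b) = 0"
    using arithmetic_on_add[of A f b "a - b"] assms by simp
  then show False
    using arithmetic_on_mult[of A f "a - b" "inverse (a - b)"] arithmetic_on_one[of A f] assms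
    by simp
qed

text \<open>\<open>B\<close> collects the values of all subterms of \<open>t\<close>, together with
  0 at each negation, since there \<open>f\<close> is applied to \<open>a + (- a) = 0\<close>.
  Allowing every \<open>A\<close> above \<open>B\<close> lets the sets of two subterms be merged by
  union.\<close>

lemma term_val_arithmetic_on:
  "\<exists>B. finite B \<and> (\<forall>A f. B \<subseteq> A \<longrightarrow> arithmetic_on A f \<longrightarrow>
     term_val v t \<in> A \<and> f (term_val v t) = term_val (\<lambda>i. f (v i)) t)"
proof (induction t)
  case (Var i)
  show ?case by (rule exI[of _ "{v i}"]) simp
next
  case Zero
  show ?case by (rule exI[of _ "{0}"]) (simp add: arithmetic_on_zero)
next
  case One
  show ?case by (rule exI[of _ "{1}"]) (simp add: arithmetic_on_one)
next
  case (Add s t)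
  then obtain B C where "finite B" "finite C"
    and "\<forall>A f. B \<subseteq> A \<longrightarrow> arithmetic_on A f \<longrightarrow>
      term_val v s \<in> A \<and> f (term_val v s) = term_val (\<lambda>i. f (v i)) s"
    and "\<forall>A f. C \<subseteq> A \<longrightarrow> arithmetic_on A f \<longrightarrow>
      term_val v t \<in> A \<and> f (term_val v t) = term_val (\<lambda>i. f (v i)) t"
    by blast
  then show ?case
    by (intro exI[of _ "insert (term_val v (Add s t)) (B \<union> C)"]) (auto simp: arithmetic_on_add)
next
  case (Neg t)
  then obtain B where "finite B"
    and "\<forall>A f. B \<subseteq> A \<longrightarrow> arithmetic_on A f \<longrightarrow>
      term_val v t \<in> A \<and> f (term_val v t) = term_val (\<lambda>i. f (v i)) t"
    by blast
  then show ?case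
    by (intro exI[of _ "insert 0 (insert (term_val v (Neg t)) B)"]) (auto simp: arithmetic_on_uminus)
next
  case (Mult s t)
  then obtain B C where "finite B" "finite C"
    and "\<forall>A f. B \<subseteq> A \<longrightarrow> arithmetic_on A f \<longrightarrow>
      term_val v s \<in> A \<and> f (term_val v s) = term_val (\<lambda>i. f (v i)) s"
    and "\<forall>A f. C \<subseteq> A \<longrightarrow> arithmetic_on A f \<longrightarrow>
      term_val v t \<in> A \<and> f (term_val v t) = term_val (\<lambda>i. f (v i)) t"
    by blast
  then show ?case
    by (intro exI[of _ "insert (term_val v (Mult s t)) (B \<union> C)"]) (auto simp: arithmetic_on_mult)
qed

text \<open>An equivalence, rather than mere preservation of truth, is what passes through
  \<open>Not\<close>, and it does so with the same \<open>B\<close>.\<close>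

lemma holds_arithmetic_on:
  "\<exists>B. finite B \<and> (\<forall>A f. B \<subseteq> A \<longrightarrow> arithmetic_on A f \<longrightarrow>
     (holds (\<lambda>i. f (v i)) \<phi> \<longleftrightarrow> holds v \<phi>))"
proof (induction \<phi>)
  case (Eq s t)
  obtain B where B: "finite B" "\<forall>A f. B \<subseteq> A \<longrightarrow> arithmetic_on A f \<longrightarrow>
      term_val v s \<in> A \<and> f (term_val v s) = term_val (\<lambda>i. f (v i)) s"
    using term_val_arithmetic_on[of v s] by blast
  obtain C where C: "finite C" "\<forall>A f. C \<subseteq> A \<longrightarrow> arithmetic_on A f \<longrightarrow>
      term_val v t \<in> A \<and> f (term_val v t) = term_val (\<lambda>i. f (v i)) t"
    using term_val_arithmetic_on[of v t] by blast
  \<comment> \<open>The inverse of \<open>d\<close> certifies that unequal sides stay unequal under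
    \<open>f\<close>. If the sides agree, \<open>d\<close> and \<open>inverse d\<close> are both 0,
    so one set covers both cases.\<close>
  define d where "d = term_val v s - term_val v t"
  show ?case
  proof (intro exI[of _ "{1, d, inverse d} \<union> B \<union> C"] conjI allI impI)
    fix A f
    assume *: "{1, d, inverse d} \<union> B \<union> C \<subseteq> A" and f: "arithmetic_on A f"
    have "term_val v s \<in> A \<and> f (term_val v s) = term_val (\<lambda>i. f (v i)) s"
      "term_val v t \<in> A \<and> f (term_val v t) = term_val (\<lambda>i. f (v i)) t"
      using B(2)[rule_format, of A f] C(2)[rule_format, of A f] * f by simp_all
    then show "holds (\<lambda>i. f (v i)) (Eq s t) \<longleftrightarrow> holds v (Eq s t)"
      using arithmetic_on_neq[OF f, of "term_val v s" "term_val v t"] * by (auto simp: d_def)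
  qed (use B(1) C(1) in simp)
next
  case (Not \<phi>)
  then show ?case by simp
next
  case (And \<phi> \<psi>)
  then obtain B C where "finite B" "finite C"
    and "\<forall>A f. B \<subseteq> A \<longrightarrow> arithmetic_on A f \<longrightarrow> (holds (\<lambda>i. f (v i)) \<phi> \<longleftrightarrow> holds v \<phi>)"
    and "\<forall>A f. C \<subseteq> A \<longrightarrow> arithmetic_on A f \<longrightarrow> (holds (\<lambda>i. f (v i)) \<psi> \<longleftrightarrow> holds v \<psi>)"
    by blast
  then show ?case
    by (intro exI[of _ "B \<union> C"]) auto
next
  case (Or \<phi> \<psi>)
  then obtain B C where "finite B" "finite C"
    and "\<forall>A f. B \<subseteq> A \<longrightarrow> arithmetic_on A f \<longrightarrow> (holds (\<lambda>i. f (v i)) \<phi> \<longleftrightarrow> holds v \<phi>)"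
    and "\<forall>A f. C \<subseteq> A \<longrightarrow> arithmetic_on A f \<longrightarrow> (holds (\<lambda>i. f (v i)) \<psi> \<longleftrightarrow> holds v \<psi>)"
    by blast
  then show ?case
    by (intro exI[of _ "B \<union> C"]) auto
qed

lemma arithmetically_fixed_if_existentially_definable:
  fixes r :: "'a::field"
  assumes "existentially_definable {r}"
  shows "arithmetically_fixed r"
proof -
  obtain n \<Gamma> where vars: "formula_vars \<Gamma> \<subseteq> {0..n}"
    and S: "{r} = {x. \<exists>xs. length xs = n \<and> holds (\<lambda>i. (x # xs) ! i) \<Gamma>}"
    using assms unfolding existentially_definable_def by blast
  then obtain xs where xs: "length xs = n" "holds (\<lambda>i. (r # xs) ! i) \<Gamma>"
    by blast
  obtain B where "finite B" and B: "\<forall>A f. B \<subseteq> A \<longrightarrow> arithmetic_on A f \<longrightarrow>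
      (holds (\<lambda>i. f ((r # xs) ! i)) \<Gamma> \<longleftrightarrow> holds (\<lambda>i. (r # xs) ! i) \<Gamma>)"
    using holds_arithmetic_on[of "\<lambda>i. (r # xs) ! i" \<Gamma>] by blast
  \<comment> \<open>Nothing known about \<open>B\<close> places \<open>r\<close> in it, so
    \<open>r\<close> is inserted separately.\<close>
  have "f r = r" if "arithmetic_on (insert r B) f" for f
  proof -
    have "holds (\<lambda>i. f ((r # xs) ! i)) \<Gamma>"
      using B that xs(2) by blast
    \<comment> \<open>Beyond the end of the lists the two assignments need not agree; the bound on
      the variables of \<Gamma> keeps every index inside.\<close>
    also have "holds (\<lambda>i. f ((r # xs) ! i)) \<Gamma> \<longleftrightarrow> holds (\<lambda>i. (f r # map f xs) ! i) \<Gamma>"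
    proof (rule holds_cong)
      fix i
      assume "i \<in> formula_vars \<Gamma>"
      then have "i < length (r # xs)"
        using vars xs(1) by auto
      then show "f ((r # xs) ! i) = (f r # map f xs) ! i"
        using nth_map[of i "r # xs" f] by simp
    qed
    \<comment> \<open>The image tuple \<open>map f xs\<close> witnesses that \<open>f r\<close>
      satisfies the formula defining \<open>{r}\<close>.\<close>
    finally have "f r \<in> {r}"
      unfolding S using xs(1) by (auto intro!: exI[of _ "map f xs"])
    then show ?thesis by simp
  qed
  then show ?thesis
    unfolding arithmetically_fixed_def using \<open>finite B\<close> by (intro exI[of _ "insert r B"]) simp
qed

theorem theorem1:
  "{x :: 'a::field. arithmetically_fixed x} = {x. existentially_definable {x}}"
  using existentially_definable_if_arithmetically_fixed
    arithmetically_fixed_if_existentially_definable by blast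

end
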